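(* Let $K=\mathbb{Q}(\sqrt{-d})$ be a complex quadratic field ($d>0$ squarefree) of discriminant $-D$. If $S$ is a finite set of rational primes containing all primes less than $\lceil \sqrt{D}/\sqrt{3}\rceil$, then $K$ is $S$-norm-Euclidean.
   Context: $D=4d$ if $-d\equiv 2,3\pmod 4$ and $D=d$ if $-d\equiv 1\pmod 4$. Put $w=\sqrt{-d}$ if $-d\equiv 2,3\pmod 4$ and $w=(1+\sqrt{-d})/2$ if $-d\equiv 1\pmod 4$. The norm is $N(x+y\sqrt{-d})=x^2+dy^2$. For a finite set $S$ of rational primes, let $T$ be the set of positive integers all of whose prime factors lie in $S$ (so $1\in T$), and $\mathcal{O}_S=\{(a+bw)/c: a,b\in\mathbb{Z}, c\in T\}$. For nonzero $\xi\in K$, $N_S(\xi)$ is the positive rational obtained from $N(\xi)$ by deleting all primes of $S$ from the prime factorizations of its numerator and denominator; $N_S(0)=0$. $K$ is $S$-norm-Euclidean if for every $\xi\in K$ there exists $\gamma\in\mathcal{O}_S$ with $N_S(\xi-\gamma)<1$. $\lceil x\rceil$ denotes the ceiling of $x$. *)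

theory Defs
  imports Complex_Main "HOL-Number_Theory.Number_Theory" "HOL-Computational_Algebra.Squarefree"
begin

text \<open>Throughout, \<open>d\<close> is a squarefree positive integer and the field is realised inside the
  complex numbers.  The function \<^const>\<open>csqrt\<close> is the principal square root, so \<open>sqrt_neg d\<close> is
  \<open>\<i> * sqrt d\<close>.\<close>

definition sqrt_neg :: "nat \<Rightarrow> complex" where
  "sqrt_neg d = csqrt (- of_nat d)"

definition quad_field :: "nat \<Rightarrow> complex set" where
  "quad_field d = {of_rat x + of_rat y * sqrt_neg d | x y :: rat. True}"

text \<open>For squarefree \<open>d\<close> the residue of \<open>-d\<close> modulo 4 is never 0, so in the next two
  definitions the \<open>else\<close> branch is the case of residue 2 or 3.\<close>

definition abs_disc :: "nat \<Rightarrow> nat" where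
  "abs_disc d = (if [- int d = 1] (mod 4) then d else 4 * d)"

definition quad_w :: "nat \<Rightarrow> complex" where
  "quad_w d = (if [- int d = 1] (mod 4) then (1 + sqrt_neg d) / 2 else sqrt_neg d)"

text \<open>The definite description is justified by \<open>quad_norm_eq\<close> below.\<close>

definition quad_norm :: "nat \<Rightarrow> complex \<Rightarrow> rat" where
  "quad_norm d \<xi> = (THE q. \<exists>x y. \<xi> = of_rat x + of_rat y * sqrt_neg d \<and> q = x\<^sup>2 + of_nat d * y\<^sup>2)"

definition S_numbers :: "nat set \<Rightarrow> nat set" where
  "S_numbers S = {n. n > 0 \<and> prime_factors n \<subseteq> S}"

definition S_ring :: "nat \<Rightarrow> nat set \<Rightarrow> complex set" where
  "S_ring d S = {(of_int a + of_int b * quad_w d) / of_nat c | a b c. c \<in> S_numbers S}"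

definition delete_primes :: "nat set \<Rightarrow> nat \<Rightarrow> nat" where
  "delete_primes S n = (\<Prod>p\<in>prime_factors n - S. p ^ multiplicity p n)"

text \<open>\<^const>\<open>quotient_of\<close> gives the reduced fraction with positive denominator.\<close>

definition S_norm :: "nat \<Rightarrow> nat set \<Rightarrow> complex \<Rightarrow> rat" where
  "S_norm d S \<xi> =
     (if \<xi> = 0 then 0
      else (let (m, n) = quotient_of (quad_norm d \<xi>)
            in of_nat (delete_primes S (nat m)) / of_nat (delete_primes S (nat n))))"

definition S_norm_Euclidean :: "nat \<Rightarrow> nat set \<Rightarrow> bool" where
  "S_norm_Euclidean d S \<longleftrightarrow>
     (\<forall>\<xi>\<in>quad_field d. \<exists>\<gamma>\<in>S_ring d S. S_norm d S (\<xi> - \<gamma>) < 1)"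

lemma sqrt_neg_eq: "sqrt_neg d = \<i> * of_real (sqrt (real d))"
  by (simp add: sqrt_neg_def complex_eq_iff)

lemma of_rat_eq_of_real: "(of_rat x :: complex) = of_real (of_rat x)"
proof (cases x)
  case (Fract a b)
  then show ?thesis by (simp add: of_rat_rat)
qed

lemma quad_coords_eq_iff:
  assumes "d > 0"
  shows "of_rat x + of_rat y * sqrt_neg d = of_rat x' + of_rat y' * sqrt_neg d
           \<longleftrightarrow> x = x' \<and> y = y'"
  using assms by (auto simp: sqrt_neg_eq of_rat_eq_of_real complex_eq_iff)

lemma quad_norm_eq:
  assumes "d > 0"
  shows "quad_norm d (of_rat x + of_rat y * sqrt_neg d) = x\<^sup>2 + of_nat d * y\<^sup>2"
  unfolding quad_norm_def by (rule the_equality) (auto simp: quad_coords_eq_iff[OF assms])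

end

theory Submission
  imports Defs
begin

text \<open>Clearing the \<open>S\<close>-part of the denominator changes no \<open>S\<close>-norm, so one may take
  \<open>\<xi> = (\<alpha> + \<beta> w) / m\<close> with \<open>m\<close> free of primes in \<open>S\<close>.  For an integer \<open>k\<close> with \<open>D < 3 k\<^sup>2\<close>,
  Dirichlet's theorem yields \<open>0 < q < k\<close> bringing \<open>q \<beta> / m\<close> within \<open>1 / k\<close> of an integer; rounding
  the real part as well leaves a remainder of norm at most \<open>1/4 + D / (4 k\<^sup>2) < 1\<close>.  All prime
  factors of \<open>q\<close> lie in \<open>S\<close>, and the denominator of the remainder contains no prime of \<open>S\<close>, so
  deleting the primes of \<open>S\<close> can only decrease this norm.\<close>

section \<open>Rational approximation with small denominator\<close>

text \<open>Pigeonhole on the fractional parts of \<open>q * y\<close> for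
  \<open>0 \<le> q < k\<close>, with \<open>k\<close> boxes of length \<open>1 / k\<close>. If two
  multiples share a box, their difference works; otherwise every box is filled, and the multiple in
  the last one lies within \<open>1 / k\<close> of the next integer. Using only \<open>k - 1\<close>
  boxes would weaken the bound to \<open>1 / (k - 1)\<close>.\<close>

lemma Dirichlet_approx_sharp:
  fixes y :: real and k :: nat
  assumes "k \<ge> 2"
  obtains q :: nat and b :: int where "0 < q" "q < k" "\<bar>real q * y - of_int b\<bar> \<le> 1 / real k"
proof -
  define f where "f q = nat \<lfloor>real k * frac (real q * y)\<rfloor>" for q :: nat
  have k: "real k > 0" using assms by simp
  have f_lower: "real (f q) \<le> real k * frac (real q * y)"
    and f_upper: "real k * frac (real q * y) < real (f q) + 1" for q
  proof -
    have "0 \<le> real k * frac (real q * y)" by simp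
    then have "real (f q) = of_int \<lfloor>real k * frac (real q * y)\<rfloor>"
      unfolding f_def by simp
    then show "real (f q) \<le> real k * frac (real q * y)"
      "real k * frac (real q * y) < real (f q) + 1" by linarith+
  qed
  have f_less: "f q < k" for q
  proof -
    have "real k * frac (real q * y) < real k * 1"
      using k frac_lt_1 by (intro mult_strict_left_mono)
    with f_lower[of q] show ?thesis by linarith
  qed
  show ?thesis
  proof (cases "inj_on f {..<k}")
    case True
    have "f ` {..<k} = {..<k}"
      by (rule endo_inj_surj) (use True f_less in auto)
    with assms obtain q where q: "q < k" "f q = k - 1"
      by (metis (no_types, lifting) diff_less imageE lessThan_iff less_le_trans pos2 zero_less_one)
    \<comment> \<open>The multiple with \<open>q = 0\<close> lies in box 0, which differs from box
      \<open>k - 1\<close> because \<open>k \<ge> 2\<close>.\<close>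
    have "q \<noteq> 0"
      using q assms by (intro notI) (simp add: f_def)
    moreover have "\<bar>real q * y - of_int (\<lfloor>real q * y\<rfloor> + 1)\<bar> \<le> 1 / real k"
    proof -
      have "real k - 1 \<le> real k * frac (real q * y)"
        using f_lower[of q] q assms by (simp add: of_nat_diff)
      then have "1 - frac (real q * y) \<le> 1 / real k"
        using k by (simp add: field_simps)
      moreover have "frac (real q * y) < 1" by (rule frac_lt_1)
      ultimately show ?thesis by (simp add: frac_def)
    qed
    ultimately show ?thesis using that[of q] q by blast
  next
    case False
    then obtain i j where ij: "i < j" "j < k" "f i = f j"
      unfolding inj_on_def by (metis lessThan_iff linorder_neqE_nat)
    have "\<bar>real k * frac (real j * y) - real k * frac (real i * y)\<bar> \<le> 1"
      using f_lower[of i] f_upper[of i] f_lower[of j] f_upper[of j] ij(3) by linarith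
    then have "real k * \<bar>frac (real j * y) - frac (real i * y)\<bar> \<le> 1"
      using k by (simp flip: right_diff_distrib add: abs_mult)
    then have "\<bar>frac (real j * y) - frac (real i * y)\<bar> \<le> 1 / real k"
      using k by (simp add: field_simps)
    moreover have "frac (real j * y) - frac (real i * y)
        = real (j - i) * y - of_int (\<lfloor>real j * y\<rfloor> - \<lfloor>real i * y\<rfloor>)"
      using ij by (simp add: frac_def of_nat_diff algebra_simps)
    ultimately have "\<bar>real (j - i) * y - of_int (\<lfloor>real j * y\<rfloor> - \<lfloor>real i * y\<rfloor>)\<bar> \<le> 1 / real k"
      by simp
    then show ?thesis using that[of "j - i"] ij by (meson less_imp_diff_less zero_less_diff)
  qed
qed

section \<open>Deleting the primes of \<open>S\<close>\<close>

lemma delete_primes_pos: "delete_primes S n > 0"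
  unfolding delete_primes_def by (intro prod_pos) (auto simp: prime_factors_gt_0_nat)

text \<open>Gives the products for different \<open>n\<close> a common index set. The guard
  \<open>if prime p\<close> forces exponent 0 at nonprime elements of \<open>A\<close>, where the
  multiplicity may be positive.\<close>

lemma delete_primes_superset:
  assumes "finite A" "prime_factors n \<subseteq> A"
  shows "delete_primes S n = (\<Prod>p\<in>A - S. p ^ (if prime p then multiplicity p n else 0))"
  unfolding delete_primes_def
proof (rule prod.mono_neutral_cong_left)
  show "\<forall>p\<in>A - S - (prime_factors n - S). p ^ (if prime p then multiplicity p n else 0) = 1"
    by (auto simp: prime_factors_multiplicity)
qed (use assms in auto)

lemma delete_primes_mult:
  assumes "a > 0" "b > 0"
  shows "delete_primes S (a * b) = delete_primes S a * delete_primes S b"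
proof -
  let ?A = "prime_factors a \<union> prime_factors b"
  have "prime_factors (a * b) = ?A"
    using assms by (simp add: prime_factors_product)
  then show ?thesis
    using assms
    by (auto simp: delete_primes_superset[of ?A] prime_elem_multiplicity_mult_distrib power_add
        simp flip: prod.distrib intro!: prod.cong)
qed

lemma delete_primes_le:
  assumes "n > 0"
  shows "delete_primes S n \<le> n"
proof -
  have "delete_primes S n dvd (\<Prod>p\<in>prime_factors n. p ^ multiplicity p n)"
    unfolding delete_primes_def by (intro prod_dvd_prod_subset) auto
  also have "\<dots> = n"
    using assms by (simp add: prime_factorization_nat[symmetric])
  finally show ?thesis using assms by (simp add: dvd_imp_le)
qed

lemma delete_primes_S_number: "n \<in> S_numbers S \<Longrightarrow> delete_primes S n = 1"
  by (simp add: S_numbers_def delete_primes_def Diff_eq_empty_iff[THEN iffD2])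

lemma delete_primes_disjoint:
  assumes "n > 0" "prime_factors n \<inter> S = {}"
  shows "delete_primes S n = n"
proof -
  have "prime_factors n - S = prime_factors n" using assms by blast
  then show ?thesis
    using assms by (simp add: delete_primes_def prime_factorization_nat[symmetric])
qed

lemma S_numbers_mult: "a \<in> S_numbers S \<Longrightarrow> b \<in> S_numbers S \<Longrightarrow> a * b \<in> S_numbers S"
  by (auto simp: S_numbers_def prime_factors_product)

text \<open>Induction over prime divisors: each new prime factor joins \<open>s\<close> or
  \<open>r\<close> according to its membership in \<open>S\<close>.\<close>

lemma S_number_factorization:
  fixes n :: nat
  assumes "n > 0"
  obtains s r where "n = s * r" "s \<in> S_numbers S" "r > 0" "prime_factors r \<inter> S = {}"
proof -
  have "n > 0 \<longrightarrow> (\<exists>s r. n = s * r \<and> s \<in> S_numbers S \<and> r > 0 \<and> prime_factors r \<inter> S = {})"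
  proof (induction n rule: prime_divisors_induct)
    case (unit x)
    then show ?case
      by (intro impI exI[of _ 1]) (auto simp: S_numbers_def)
  next
    case (factor p x)
    show ?case
    proof
      assume "p * x > 0"
      then have "x > 0" by simp
      with factor.IH obtain s r where
        sr: "x = s * r" "s \<in> S_numbers S" "r > 0" "prime_factors r \<inter> S = {}" by blast
      have p: "p > 0" "prime_factors p = {p}"
        using factor.hyps by (simp_all add: prime_gt_0_nat prime_prime_factors)
      show "\<exists>s r. p * x = s * r \<and> s \<in> S_numbers S \<and> r > 0 \<and> prime_factors r \<inter> S = {}"
      proof (cases "p \<in> S")
        case True
        with sr p have "p * s \<in> S_numbers S"
          by (intro S_numbers_mult) (auto simp: S_numbers_def)
        with sr show ?thesis
          by (intro exI[of _ "p * s"] exI[of _ r]) simp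
      next
        case False
        with sr p have "prime_factors (p * r) \<inter> S = {}"
          by (auto simp: prime_factors_product)
        with sr p show ?thesis
          by (intro exI[of _ s] exI[of _ "p * r"]) simp
      qed
    qed
  qed simp
  with assms that show ?thesis by blast
qed

text \<open>Cross-multiplying with the reduced fraction and using multiplicativity of
  \<open>delete_primes\<close> shows that the S-norm can be read off from any fraction, reduced or
  not.\<close>

lemma S_norm_eq:
  fixes a b :: nat
  assumes "\<xi> \<noteq> 0" "a > 0" "b > 0" "quad_norm d \<xi> = of_nat a / of_nat b"
  shows "S_norm d S \<xi> = of_nat (delete_primes S a) / of_nat (delete_primes S b)"
proof -
  obtain m n where mn: "quotient_of (quad_norm d \<xi>) = (m, n)" by fastforce
  have n: "n > 0" using mn by (rule quotient_of_denom_pos)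
  have eq: "(of_nat a / of_nat b :: rat) = of_int m / of_int n"
    using quotient_of_div[OF mn] assms by simp
  have "(of_int m / of_int n :: rat) > 0"
    unfolding eq[symmetric] using assms by simp
  with n have m: "m > 0" by (simp add: zero_less_divide_iff)
  have "of_int (int a * n) = (of_int (m * int b) :: rat)"
    using eq n assms by (simp add: field_simps)
  then have "int a * n = m * int b" by (simp only: of_int_eq_iff)
  then have "a * nat n = nat m * b"
    using m n by (metis nat_int nat_mult_distrib of_nat_0_le_iff less_imp_le)
  then have "delete_primes S (a * nat n) = delete_primes S (nat m * b)" by simp
  then have "delete_primes S a * delete_primes S (nat n)
      = delete_primes S (nat m) * delete_primes S b"
    using assms m n by (simp add: delete_primes_mult)
  then have "(of_nat (delete_primes S a) * of_nat (delete_primes S (nat n)) :: rat)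
      = of_nat (delete_primes S (nat m)) * of_nat (delete_primes S b)"
    by (metis of_nat_mult)
  then show ?thesis
    using assms mn delete_primes_pos[of S] by (simp add: S_norm_def field_simps)
qed

section \<open>The norm form in the basis \<open>1\<close>, \<open>quad_w d\<close>\<close>

text \<open>Here \<open>t\<close> and \<open>n\<close> are the trace and norm of
  \<open>quad_w d\<close>: 1 and \<open>(1 + d) / 4\<close>, or 0 and \<open>d\<close>. With them
  both residue classes are treated by one norm form.\<close>

lemma quad_norm_integral_coords:
  assumes "d > 0"
  obtains t n :: int where "4 * n - t\<^sup>2 = int (abs_disc d)"
    "\<And>x y (c::nat). c > 0 \<Longrightarrow>
       quad_norm d ((of_int x + of_int y * quad_w d) / of_nat c)
         = of_int (x\<^sup>2 + t * x * y + n * y\<^sup>2) / of_nat (c\<^sup>2)"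
proof (cases "[- int d = 1] (mod 4)")
  case True
  then have "4 dvd - int d - 1" by (simp add: cong_iff_dvd_diff)
  then have "4 dvd 1 + int d" by presburger
  then obtain n where n: "1 + int d = 4 * n" ..
  show ?thesis
  proof (rule that[of n 1])
    show "4 * n - 1\<^sup>2 = int (abs_disc d)"
      using True n by (simp add: abs_disc_def)
  next
    fix x y :: int and c :: nat
    assume c: "c > 0"
    have "(of_int x + of_int y * quad_w d) / of_nat c
        = of_rat ((of_int x + of_int y / 2) / of_nat c) + of_rat (of_int y / (2 * of_nat c)) * sqrt_neg d"
      using True c by (simp add: quad_w_def of_rat_divide of_rat_add of_rat_mult field_simps)
    moreover have "(of_nat d :: rat) = 4 * of_int n - 1"
      using arg_cong[OF n, of "of_int :: int \<Rightarrow> rat"] by simp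
    ultimately show "quad_norm d ((of_int x + of_int y * quad_w d) / of_nat c)
         = of_int (x\<^sup>2 + 1 * x * y + n * y\<^sup>2) / of_nat (c\<^sup>2)"
      using c by (simp only: quad_norm_eq[OF assms]) (simp add: field_simps power2_eq_square)
  qed
next
  case False
  show ?thesis
  proof (rule that[of "int d" 0])
    show "4 * int d - 0\<^sup>2 = int (abs_disc d)"
      using False by (simp add: abs_disc_def)
  next
    fix x y :: int and c :: nat
    assume c: "c > 0"
    have "(of_int x + of_int y * quad_w d) / of_nat c
        = of_rat (of_int x / of_nat c) + of_rat (of_int y / of_nat c) * sqrt_neg d"
      using False c by (simp add: quad_w_def of_rat_divide field_simps)
    then show "quad_norm d ((of_int x + of_int y * quad_w d) / of_nat c)
         = of_int (x\<^sup>2 + 0 * x * y + int d * y\<^sup>2) / of_nat (c\<^sup>2)"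
      using c by (simp only: quad_norm_eq[OF assms]) (simp add: field_simps power2_eq_square)
  qed
qed

lemma quad_field_integral_coords:
  assumes "\<xi> \<in> quad_field d"
  obtains a b :: int and m :: nat where "m > 0" "\<xi> = (of_int a + of_int b * quad_w d) / of_nat m"
proof -
  obtain x y where xy: "\<xi> = of_rat x + of_rat y * sqrt_neg d"
    using assms by (auto simp: quad_field_def)
  obtain a b where ab: "quotient_of x = (a, b)" by fastforce
  obtain e f where ef: "quotient_of y = (e, f)" by fastforce
  have pos: "b > 0" "f > 0"
    using ab ef by (auto intro: quotient_of_denom_pos)
  have bf: "(of_nat (nat (b * f)) :: complex) = of_int b * of_int f"
    using pos by simp
  have "\<xi> = of_int a / of_int b + of_int e / of_int f * sqrt_neg d"
    by (simp add: xy quotient_of_div[OF ab] quotient_of_div[OF ef] of_rat_divide)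
  then have \<xi>: "\<xi> = (of_int (a * f) + of_int (e * b) * sqrt_neg d) / of_nat (nat (b * f))"
    unfolding bf using pos by (simp add: field_simps)
  show ?thesis
  proof (cases "[- int d = 1] (mod 4)")
    case True
    then have "sqrt_neg d = 2 * quad_w d - 1" by (simp add: quad_w_def field_simps)
    with \<xi> have "\<xi> = (of_int (a * f - e * b) + of_int (2 * e * b) * quad_w d) / of_nat (nat (b * f))"
      by (simp add: algebra_simps)
    with that show ?thesis using pos by (metis mult_pos_pos zero_less_nat_eq)
  next
    case False
    then have "sqrt_neg d = quad_w d" by (simp add: quad_w_def)
    with \<xi> that show ?thesis using pos by (metis mult_pos_pos zero_less_nat_eq)
  qed
qed

text \<open>Equality would make \<open>k\<^sup>2\<close> a divisor of \<open>d\<close> when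
  \<open>D = d\<close>. When \<open>D = 4 d\<close>, it makes \<open>k = 2 j\<close> even and
  \<open>d = 3 j\<^sup>2\<close>, hence \<open>d = 3\<close>; but -3 is 1 modulo 4.\<close>

lemma abs_disc_neq_3_times_square:
  assumes "squarefree d" "k \<ge> 2"
  shows "abs_disc d \<noteq> 3 * k\<^sup>2"
proof
  assume eq: "abs_disc d = 3 * k\<^sup>2"
  show False
  proof (cases "[- int d = 1] (mod 4)")
    case True
    with eq have "k\<^sup>2 dvd d" by (simp add: abs_disc_def)
    with assms have "k dvd 1" unfolding squarefree_def by blast
    with assms show False by simp
  next
    case False
    with eq have eq': "4 * d = 3 * k\<^sup>2" by (simp add: abs_disc_def)
    have "even (3 * k\<^sup>2)" unfolding eq'[symmetric] by simp
    then have "even k" by simp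
    then obtain j where "k = 2 * j" ..
    with eq' have d: "d = 3 * j\<^sup>2" by (simp add: power2_eq_square)
    then have "j\<^sup>2 dvd d" by simp
    with assms have "j dvd 1" unfolding squarefree_def by blast
    with d have "d = 3" by simp
    with False show False by (simp add: cong_def)
  qed
qed

section \<open>Choice of the approximating S-integer\<close>

theorem theorem2:
  fixes d :: nat and S :: "nat set"
  assumes "d > 0" and "squarefree d"
    and "finite S" and "\<forall>p\<in>S. prime p"
    and "\<forall>p. prime p \<and> int p < \<lceil>sqrt (real (abs_disc d)) / sqrt 3\<rceil> \<longrightarrow> p \<in> S"
  shows "S_norm_Euclidean d S"
  unfolding S_norm_Euclidean_def
proof
  fix \<xi> assume "\<xi> \<in> quad_field d"
  then obtain a b m where m: "m > 0" and \<xi>: "\<xi> = (of_int a + of_int b * quad_w d) / of_nat m"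
    by (rule quad_field_integral_coords)
  obtain s r where m_eq: "m = s * r" and s: "s \<in> S_numbers S"
    and r: "r > 0" "prime_factors r \<inter> S = {}"
    using m by (rule S_number_factorization)
  obtain t n where disc: "4 * n - t\<^sup>2 = int (abs_disc d)"
    and norm: "\<And>x y (c::nat). c > 0 \<Longrightarrow>
       quad_norm d ((of_int x + of_int y * quad_w d) / of_nat c)
         = of_int (x\<^sup>2 + t * x * y + n * y\<^sup>2) / of_nat (c\<^sup>2)"
    using quad_norm_integral_coords[OF \<open>d > 0\<close>] by metis
  \<comment> \<open>The maximum with 2 covers \<open>D = 3\<close>, where the ceiling is 1 and leaves no room for \<open>q\<close>.\<close>
  define k where "k = max 2 (nat \<lceil>sqrt (real (abs_disc d)) / sqrt 3\<rceil>)"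
  have k2: "k \<ge> 2" by (simp add: k_def)
  have disc_less: "real (abs_disc d) < 3 * (real k)\<^sup>2"
  proof -
    have "sqrt (real (abs_disc d)) / sqrt 3 \<le> real k"
      unfolding k_def by linarith
    then have "sqrt (real (abs_disc d)) \<le> real k * sqrt 3" by (simp add: field_simps)
    then have "(sqrt (real (abs_disc d)))\<^sup>2 \<le> (real k * sqrt 3)\<^sup>2" by (intro power_mono) auto
    then have "real (abs_disc d) \<le> real (3 * k\<^sup>2)" by (simp add: power_mult_distrib)
    \<comment> \<open>Strictness matters: with equality the bounds 1/4 and 3/4 used below would only
      give a sum of at most 1.\<close>
    with abs_disc_neq_3_times_square[OF \<open>squarefree d\<close> k2] have "abs_disc d < 3 * k\<^sup>2" by linarith
    then have "real (abs_disc d) < real (3 * k\<^sup>2)" by (simp only: of_nat_less_iff)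
    then show ?thesis by simp
  qed
  \<comment> \<open>The target is \<open>b / r\<close> rather than \<open>b / m\<close>: the factor
    \<open>s\<close> is an S-number and goes into the denominator of
    \<open>\<gamma>\<close>.\<close>
  obtain q B where q: "0 < q" "q < k" and B: "\<bar>real q * (of_int b / real r) - of_int B\<bar> \<le> 1 / real k"
    using Dirichlet_approx_sharp[OF k2] by blast
  have q_S: "q \<in> S_numbers S"
  proof -
    have "p \<in> S" if "p \<in> prime_factors q" for p
    proof -
      from that q have p: "prime p" "p \<le> q" by (auto intro: dvd_imp_le)
      \<comment> \<open>Since \<open>2 \<le> p \<le> q < k\<close>, the maximum defining
        \<open>k\<close> is the ceiling and not 2.\<close>
      with q prime_ge_2_nat[of p] have "int p < \<lceil>sqrt (real (abs_disc d)) / sqrt 3\<rceil>"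
        by (auto simp: k_def max_def split: if_splits)
      with p assms show ?thesis by blast
    qed
    with q show ?thesis by (auto simp: S_numbers_def)
  qed
  define v where "v = real q * (of_int b / real r) - of_int B"
  \<comment> \<open>Completing the square in the norm form produces \<open>u + t / 2 * v\<close>, so
    the rounding is applied to the shifted value and not to \<open>q * a / r\<close>.\<close>
  define A where "A = round (real q * (of_int a / real r) + of_int t / 2 * v)"
  define u where "u = real q * (of_int a / real r) - of_int A"
  have u: "\<bar>u + of_int t / 2 * v\<bar> \<le> 1 / 2"
    using of_int_round_abs_le[of "real q * (of_int a / real r) + of_int t / 2 * v"]
    unfolding u_def A_def by (simp add: abs_minus_commute algebra_simps)
  \<comment> \<open>\<open>X + Y w\<close> is the numerator of \<open>\<xi> - \<gamma>\<close> over
    \<open>q * s * r\<close>, and \<open>M\<close> is the norm of that numerator.\<close>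
  define X where "X = int q * a - A * int r"
  define Y where "Y = int q * b - B * int r"
  define M where "M = X\<^sup>2 + t * X * Y + n * Y\<^sup>2"
  define \<gamma> where "\<gamma> = (of_int A + of_int B * quad_w d) / of_nat (q * s)"
  have \<gamma>: "\<gamma> \<in> S_ring d S"
    using S_numbers_mult[OF q_S s] unfolding \<gamma>_def S_ring_def by blast
  have s0: "s > 0" using m m_eq by simp
  define c where "c = (q * s) * r"
  have c: "c > 0" using q s0 r by (simp add: c_def)
  have diff: "\<xi> - \<gamma> = (of_int X + of_int Y * quad_w d) / of_nat c"
    using q s0 r unfolding \<xi> \<gamma>_def c_def m_eq X_def Y_def by (simp add: field_simps)
  have disc_real: "4 * of_int n - (of_int t)\<^sup>2 = real (abs_disc d)"
    using arg_cong[OF disc, of "of_int :: int \<Rightarrow> real"] by simp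
  have XY: "of_int X = real r * u" "of_int Y = real r * v"
    using r by (simp_all add: X_def Y_def u_def v_def field_simps)
  have M_eq: "of_int M = (real r)\<^sup>2 * ((u + of_int t / 2 * v)\<^sup>2 + real (abs_disc d) / 4 * v\<^sup>2)"
    unfolding M_def of_int_add of_int_mult of_int_power XY disc_real[symmetric]
    by (simp add: field_simps power2_eq_square)
  have "(u + of_int t / 2 * v)\<^sup>2 \<le> (1 / 2)\<^sup>2"
    using u by (metis abs_le_square_iff abs_of_nonneg zero_le_divide_1_iff zero_le_numeral)
  moreover have "real (abs_disc d) / 4 * v\<^sup>2 < 3 / 4"
  proof -
    have "\<bar>v\<bar>\<^sup>2 \<le> (1 / real k)\<^sup>2"
      using B unfolding v_def by (intro power_mono) auto
    then have "real (abs_disc d) / 4 * v\<^sup>2 \<le> real (abs_disc d) / 4 * (1 / real k)\<^sup>2"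
      by (intro mult_left_mono) auto
    also have "\<dots> < 3 / 4"
      using disc_less k2 by (simp add: field_simps power2_eq_square)
    finally show ?thesis .
  qed
  ultimately have "(u + of_int t / 2 * v)\<^sup>2 + real (abs_disc d) / 4 * v\<^sup>2 < 1"
    by (simp add: power2_eq_square)
  then have "real_of_int M < (real r)\<^sup>2 * 1"
    unfolding M_eq using r by (intro mult_strict_left_mono) auto
  then have "real_of_int M < of_int (int (r\<^sup>2))" by simp
  then have M_less: "M < int (r\<^sup>2)" by (simp only: of_int_less_iff)
  have "real_of_int M \<ge> 0" unfolding M_eq by simp
  then have M_nonneg: "M \<ge> 0" by simp
  have "S_norm d S (\<xi> - \<gamma>) < 1"
  proof (cases "\<xi> - \<gamma> = 0")
    case True
    then show ?thesis by (simp add: S_norm_def)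
  next
    case False
    have norm_eq: "quad_norm d (\<xi> - \<gamma>) = of_nat (nat M) / of_nat (c\<^sup>2)"
      unfolding diff norm[OF c] M_def[symmetric] using M_nonneg by simp
    \<comment> \<open>The norm form is positive definite, so \<open>M = 0\<close> would force
      \<open>\<xi> = \<gamma>\<close>.\<close>
    have "M \<noteq> 0"
    proof
      assume "M = 0"
      then have "(u + of_int t / 2 * v)\<^sup>2 + real (abs_disc d) / 4 * v\<^sup>2 = 0"
        using M_eq r by simp
      moreover have "abs_disc d > 0" using \<open>d > 0\<close> by (simp add: abs_disc_def)
      ultimately have "v = 0" "u = 0"
        by (auto simp: add_nonneg_eq_0_iff)
      with XY diff False show False by simp
    qed
    with M_nonneg have M_pos: "nat M > 0" by simp
    \<comment> \<open>Deletion can only shrink the numerator \<open>M\<close>, while in the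
      denominator it removes \<open>q\<close> and \<open>s\<close> and leaves \<open>r\<close>
      intact.\<close>
    have "delete_primes S (nat M) < r\<^sup>2"
      using delete_primes_le[OF M_pos, of S] M_less M_nonneg by (simp add: nat_less_iff le_less_trans)
    moreover have "delete_primes S (c\<^sup>2) = r\<^sup>2"
      using delete_primes_S_number[OF q_S] delete_primes_S_number[OF s] delete_primes_disjoint[OF r]
        q s0 r by (simp add: c_def power2_eq_square delete_primes_mult)
    ultimately have "(of_nat (delete_primes S (nat M)) :: rat) < of_nat (delete_primes S (c\<^sup>2))"
      by (simp only: of_nat_less_iff)
    then show ?thesis
      using S_norm_eq[OF False M_pos _ norm_eq, of S] c delete_primes_pos[of S "c\<^sup>2"]
      by simp
  qed
  with \<gamma> show "\<exists>\<gamma>\<in>S_ring d S. S_norm d S (\<xi> - \<gamma>) < 1" by blast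
qed

end
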